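(* Let $k\ge 1$ be an integer and let $G$ be a group that can be generated by $k$ elements. The following are equivalent: (i) there is a finite constant $N$ such that the girth of $G$ with respect to every $k$-element generating set of $G$ is at most $N$; (ii) $G$ satisfies a non-trivial $k$-almost identity, i.e. there is a $k$-almost identity $u$ of $G$ that is a non-trivial element of the free group $F_k$ of rank $k$.
   Context: A word $u$ in $k$ variables (an element of the free group $F_k$) is called a $k$-almost identity of a $k$-generated group $G$ if $u(a_1,\dots,a_k)=1$ in $G$ for every generating set $\{a_1,\dots,a_k\}$ of $G$. Here generating sets $\{a_1,\dots,a_k\}$ are understood as generating $k$-tuples $(a_1,\dots,a_k)$, so that the set of $k$-almost identities of $G$ is the intersection of the kernels of all epimorphisms $F_k\to G$. The girth of $G$ with respect to a generating set $\{a_1,\dots,a_k\}$ is the minimal length of a simple loop in the Cayley graph of $G$ with respect to it (with one edge joining $g$ and $ga_j$ for each $g\in G$ and each index $j$; loops and multiple edges allowed). Equivalently, it is the minimal length of a non-trivial reduced word $w\in F_k$ with $w(a_1,\dots,a_k)=1$ in $G$; it is $\infty$ if there is no such word. *)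

theory Defs
  imports "HOL-Algebra.Algebra" "HOL-Library.Extended_Nat"
begin

text \<open>
  The letter \<open>(i, True)\<close> stands for the variable \<open>x\<^sub>i\<close> and \<open>(i, False)\<close> for its formal inverse;
  the variables are \<open>x\<^sub>0, \<dots>, x\<^sub>k\<^sub>-\<^sub>1\<close>. Elements of the free group are reduced words.
\<close>

type_synonym letter = "nat \<times> bool"

definition inv_letter :: "letter \<Rightarrow> letter" where
  "inv_letter x = (fst x, \<not> snd x)"

definition reduced :: "letter list \<Rightarrow> bool" where
  "reduced w \<longleftrightarrow> (\<forall>i. Suc i < length w \<longrightarrow> w ! Suc i \<noteq> inv_letter (w ! i))"

definition cons_reduce :: "letter \<Rightarrow> letter list \<Rightarrow> letter list" where
  "cons_reduce x w = (if w \<noteq> [] \<and> hd w = inv_letter x then tl w else x # w)"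

definition free_group :: "nat \<Rightarrow> letter list monoid" where
  "free_group k =
     \<lparr>carrier = {w. reduced w \<and> fst ` set w \<subseteq> {..<k}},
      monoid.mult = (\<lambda>u v. foldr cons_reduce u v),
      one = []\<rparr>"

definition letter_value :: "('a, 'b) monoid_scheme \<Rightarrow> 'a list \<Rightarrow> letter \<Rightarrow> 'a" where
  "letter_value G a x = (if snd x then a ! fst x else inv\<^bsub>G\<^esub> (a ! fst x))"

definition word_value :: "('a, 'b) monoid_scheme \<Rightarrow> 'a list \<Rightarrow> letter list \<Rightarrow> 'a" where
  "word_value G a w = foldr (\<lambda>x g. letter_value G a x \<otimes>\<^bsub>G\<^esub> g) w \<one>\<^bsub>G\<^esub>"

text \<open>Generating sets are indexed: a generating tuple may have repeated entries.\<close>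

definition generating_tuple :: "('a, 'b) monoid_scheme \<Rightarrow> nat \<Rightarrow> 'a list \<Rightarrow> bool" where
  "generating_tuple G k a \<longleftrightarrow>
     length a = k \<and> set a \<subseteq> carrier G \<and> generate G (set a) = carrier G"

definition almost_identity :: "('a, 'b) monoid_scheme \<Rightarrow> nat \<Rightarrow> letter list \<Rightarrow> bool" where
  "almost_identity G k u \<longleftrightarrow>
     u \<in> carrier (free_group k) \<and>
     (\<forall>a. generating_tuple G k a \<longrightarrow> word_value G a u = \<one>\<^bsub>G\<^esub>)"

text \<open>
  The Cayley graph is an undirected multigraph: for all \<open>g\<close> in \<open>G\<close> and \<open>j < length a\<close> the pair
  \<open>(g, j)\<close> is an edge with ends \<open>g\<close> and \<open>g a\<^sub>j\<close>. Loops occur if \<open>a\<^sub>j = 1\<close>; multiple edges occur,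
  for instance, as \<open>(g, j)\<close> and \<open>(g a\<^sub>j, j)\<close> if \<open>a\<^sub>j\<close> is an involution.
\<close>

definition cayley_edges :: "('a, 'b) monoid_scheme \<Rightarrow> 'a list \<Rightarrow> ('a \<times> nat) set" where
  "cayley_edges G a = carrier G \<times> {..<length a}"

definition edge_ends :: "('a, 'b) monoid_scheme \<Rightarrow> 'a list \<Rightarrow> 'a \<times> nat \<Rightarrow> 'a set" where
  "edge_ends G a e = {fst e, fst e \<otimes>\<^bsub>G\<^esub> (a ! snd e)}"

text \<open>
  A simple loop runs through pairwise distinct vertices \<open>v\<^sub>0, \<dots>, v\<^sub>n\<^sub>-\<^sub>1\<close> along pairwise distinct edges
  and returns to \<open>v\<^sub>0\<close>. Distinctness of the edges matters only for \<open>n = 2\<close>, where it excludes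
  traversing one edge back and forth.
\<close>

definition simple_loop ::
    "('a, 'b) monoid_scheme \<Rightarrow> 'a list \<Rightarrow> 'a list \<Rightarrow> ('a \<times> nat) list \<Rightarrow> bool" where
  "simple_loop G a vs es \<longleftrightarrow>
     vs \<noteq> [] \<and> length es = length vs \<and>
     set vs \<subseteq> carrier G \<and> set es \<subseteq> cayley_edges G a \<and>
     distinct vs \<and> distinct es \<and>
     (\<forall>i < length vs. edge_ends G a (es ! i) = {vs ! i, vs ! (Suc i mod length vs)})"

text \<open>The infimum of the empty set is \<open>\<infinity>\<close>.\<close>

definition girth :: "('a, 'b) monoid_scheme \<Rightarrow> 'a list \<Rightarrow> enat" where
  "girth G a = Inf {enat (length es) | vs es. simple_loop G a vs es}"

lemma inv_letter_inv_letter [simp]: "inv_letter (inv_letter x) = x"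
  by (simp add: inv_letter_def)

lemma fst_inv_letter [simp]: "fst (inv_letter x) = fst x"
  by (simp add: inv_letter_def)

lemma reduced_Nil [simp]: "reduced []"
  by (simp add: reduced_def)

lemma reduced_Cons:
  "reduced (x # w) \<longleftrightarrow> (w \<noteq> [] \<longrightarrow> hd w \<noteq> inv_letter x) \<and> reduced w"
proof -
  have *: "(\<forall>i. P i) \<longleftrightarrow> P 0 \<and> (\<forall>i. P (Suc i))" for P :: "nat \<Rightarrow> bool"
    using not0_implies_Suc by metis
  show ?thesis
    unfolding reduced_def by (subst *) (cases w, auto)
qed

lemma reduced_cons_reduce: "reduced w \<Longrightarrow> reduced (cons_reduce x w)"
  by (cases w) (auto simp: cons_reduce_def reduced_Cons)

lemma reduced_foldr: "reduced w \<Longrightarrow> reduced (foldr cons_reduce u w)"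
  by (induction u) (auto simp: reduced_cons_reduce)

lemma cons_reduce_inverse:
  "reduced w \<Longrightarrow> cons_reduce x (cons_reduce (inv_letter x) w) = w"
  by (cases w) (auto simp: cons_reduce_def reduced_Cons)

lemma foldr_cons_reduce:
  assumes "reduced w"
  shows "foldr cons_reduce (cons_reduce x u) w = cons_reduce x (foldr cons_reduce u w)"
proof (cases "u \<noteq> [] \<and> hd u = inv_letter x")
  case True
  then obtain u' where "u = inv_letter x # u'" by (metis list.collapse)
  then show ?thesis
    using assms by (simp add: cons_reduce_def[of x "_ # _"] cons_reduce_inverse reduced_foldr)
qed (auto simp: cons_reduce_def[of x u])

lemma foldr_cons_reduce_assoc:
  assumes "reduced w"
  shows "foldr cons_reduce (foldr cons_reduce u v) w = foldr cons_reduce u (foldr cons_reduce v w)"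
  using assms by (induction u) (auto simp: foldr_cons_reduce)

lemma foldr_cons_reduce_Nil: "reduced w \<Longrightarrow> foldr cons_reduce w [] = w"
  by (induction w) (auto simp: reduced_Cons cons_reduce_def)

lemma set_foldr_cons_reduce: "set (foldr cons_reduce u v) \<subseteq> set u \<union> set v"
proof (induction u)
  case (Cons x u)
  have "set (cons_reduce x w) \<subseteq> insert x (set w)" for w
    by (cases w) (auto simp: cons_reduce_def)
  then show ?case using Cons by fastforce
qed simp

lemma cancel_inverse_word:
  "reduced v \<Longrightarrow> foldr cons_reduce (rev (map inv_letter w)) (foldr cons_reduce w v) = v"
proof (induction w arbitrary: v)
  case (Cons x w)
  then show ?case
    using cons_reduce_inverse[of "foldr cons_reduce w v" "inv_letter x"]
    by (simp add: reduced_foldr)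
qed simp

theorem group_free_group: "group (free_group k)"
proof (rule groupI)
  fix u assume u: "u \<in> carrier (free_group k)"
  let ?v = "foldr cons_reduce (rev (map inv_letter u)) []"
  have "?v \<in> carrier (free_group k)"
    using u set_foldr_cons_reduce[of "rev (map inv_letter u)" "[]"]
    by (fastforce simp: free_group_def reduced_foldr)
  moreover have "?v \<otimes>\<^bsub>free_group k\<^esub> u = \<one>\<^bsub>free_group k\<^esub>"
    using u cancel_inverse_word[of "[]" u] foldr_cons_reduce_assoc[of u "rev (map inv_letter u)" "[]"]
    by (simp add: free_group_def foldr_cons_reduce_Nil)
  ultimately show "\<exists>v\<in>carrier (free_group k). v \<otimes>\<^bsub>free_group k\<^esub> u = \<one>\<^bsub>free_group k\<^esub>" by blast
next
  fix u v assume "u \<in> carrier (free_group k)" "v \<in> carrier (free_group k)"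
  then show "u \<otimes>\<^bsub>free_group k\<^esub> v \<in> carrier (free_group k)"
    using set_foldr_cons_reduce[of u v] by (fastforce simp: free_group_def reduced_foldr)
qed (auto simp: free_group_def foldr_cons_reduce_assoc)

lemma (in group) letter_value_closed:
  "set a \<subseteq> carrier G \<Longrightarrow> fst x < length a \<Longrightarrow> letter_value G a x \<in> carrier G"
  by (simp add: letter_value_def subset_code(1))

lemma (in group) word_value_closed:
  "set a \<subseteq> carrier G \<Longrightarrow> fst ` set w \<subseteq> {..<length a} \<Longrightarrow> word_value G a w \<in> carrier G"
  by (induction w) (auto simp: word_value_def letter_value_closed)

lemma (in group) word_value_cons_reduce:
  assumes a: "set a \<subseteq> carrier G" and x: "fst x < length a" and w: "fst ` set w \<subseteq> {..<length a}"
  shows "word_value G a (cons_reduce x w) = letter_value G a x \<otimes> word_value G a w"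
proof (cases "w \<noteq> [] \<and> hd w = inv_letter x")
  case True
  then obtain w' where w': "w = inv_letter x # w'" by (metis list.collapse)
  have "a ! fst x \<in> carrier G" using a x by (meson nth_mem subsetD)
  moreover have "word_value G a w' \<in> carrier G"
    using a w by (intro word_value_closed) (auto simp: w')
  ultimately show ?thesis
    by (auto simp: w' cons_reduce_def word_value_def letter_value_def inv_letter_def
        m_assoc[symmetric])
qed (auto simp: cons_reduce_def word_value_def)

theorem (in group) word_value_hom:
  assumes a: "set a \<subseteq> carrier G"
  shows "word_value G a \<in> hom (free_group (length a)) G"
proof (rule homI)
  fix u v assume "u \<in> carrier (free_group (length a))" "v \<in> carrier (free_group (length a))"
  then have u: "fst ` set u \<subseteq> {..<length a}" and v: "fst ` set v \<subseteq> {..<length a}"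
    by (auto simp: free_group_def)
  have "word_value G a (foldr cons_reduce u v) = word_value G a u \<otimes> word_value G a v"
    using u
  proof (induction u)
    case Nil
    show ?case using a v by (simp add: word_value_def[of G a "[]"] word_value_closed)
  next
    case (Cons x u)
    have "fst ` set (foldr cons_reduce u v) \<subseteq> {..<length a}"
      using Cons.prems v set_foldr_cons_reduce[of u v] by fastforce
    moreover have "word_value G a (x # u) = letter_value G a x \<otimes> word_value G a u"
      by (simp add: word_value_def)
    ultimately show ?case
      using a Cons v
      by (simp add: word_value_cons_reduce m_assoc letter_value_closed word_value_closed)
  qed
  then show "word_value G a (u \<otimes>\<^bsub>free_group (length a)\<^esub> v) = word_value G a u \<otimes> word_value G a v"
    by (simp add: free_group_def)
qed (use a in \<open>auto simp: free_group_def intro: word_value_closed\<close>)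

end

theory Submission imports Defs begin

text \<open>
  A bound on the girth leaves finitely many words, one of which vanishes on each generating tuple;
  so it suffices to merge two non-trivial words \<open>u\<close>, \<open>v\<close> into one that vanishes whenever \<open>u\<close> or
  \<open>v\<close> does. For \<open>k = 1\<close> a power works. For \<open>k \<ge> 2\<close> there are at least four letters, so one can
  conjugate \<open>u\<close> and \<open>v\<close> by different letters \<open>x\<close> and \<open>y\<close> without cancellation; the commutator of
  \<open>x u x\<^sup>-\<^sup>1\<close> and \<open>y v y\<^sup>-\<^sup>1\<close> is then reduced as written. In the other direction, a shortest
  non-trivial reduced word that vanishes on a tuple traces a simple loop.
\<close>

definition inv_word :: "letter list \<Rightarrow> letter list" where
  "inv_word w = rev (map inv_letter w)"

text \<open>The edge that a path crosses when it leaves \<open>g\<close> along the letter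
  \<open>x\<close>. An inverse letter runs against the direction of its edge, so the base point
  recorded there is the vertex arrived at.\<close>

definition letter_edge :: "('a, 'b) monoid_scheme \<Rightarrow> 'a list \<Rightarrow> 'a \<Rightarrow> letter \<Rightarrow> 'a \<times> nat" where
  "letter_edge G a g x = (if snd x then g else g \<otimes>\<^bsub>G\<^esub> letter_value G a x, fst x)"

section \<open>Reduced words under concatenation and inversion\<close>

lemma reduced_append:
  "reduced (u @ v) \<longleftrightarrow>
     reduced u \<and> reduced v \<and> (u \<noteq> [] \<longrightarrow> v \<noteq> [] \<longrightarrow> hd v \<noteq> inv_letter (last u))"
  by (induction u) (auto simp: reduced_Cons)

lemma inv_letter_eq_iff: "inv_letter x = y \<longleftrightarrow> x = inv_letter y"
  by auto

lemma reduced_inv_word: "reduced w \<Longrightarrow> reduced (inv_word w)"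
proof (induction w)
  case (Cons x w)
  then show ?case
    by (auto simp: inv_word_def reduced_append reduced_Cons last_rev hd_map)
qed (simp add: inv_word_def)

lemma inv_word_eq_Nil_iff [simp]: "inv_word w = [] \<longleftrightarrow> w = []"
  by (simp add: inv_word_def)

lemma hd_inv_word: "w \<noteq> [] \<Longrightarrow> hd (inv_word w) = inv_letter (last w)"
  by (simp add: inv_word_def hd_rev last_map)

lemma last_inv_word: "w \<noteq> [] \<Longrightarrow> last (inv_word w) = inv_letter (hd w)"
  by (simp add: inv_word_def last_rev hd_map)

lemma fst_set_inv_word: "fst ` set (inv_word w) = fst ` set w"
  by (simp add: inv_word_def image_image)

text \<open>The last two assumptions forbid cancellation at the two seams of the conjugate.\<close>

lemma reduced_conjugate:
  assumes "reduced w" "w \<noteq> []" "hd w \<noteq> inv_letter x" "last w \<noteq> x"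
  shows "reduced (x # w @ [inv_letter x])"
  using assms by (auto simp: reduced_Cons reduced_append inv_letter_eq_iff)

text \<open>Two variables and their inverses are already four letters, one more than
  \<open>A\<close> can contain.\<close>

lemma ex_letter_notin:
  assumes "k \<ge> 2" "finite A" "card A \<le> 3"
  obtains x :: letter where "fst x < k" "x \<notin> A"
proof -
  let ?L = "{(0, True), (0, False), (1, True), (1, False)} :: letter set"
  have "\<not> ?L \<subseteq> A"
    using card_mono[OF assms(2), of ?L] assms(3) by auto
  then obtain x where "x \<in> ?L" "x \<notin> A" by blast
  moreover from this(1) have "fst x < k" using assms(1) by auto
  ultimately show ?thesis using that by blast
qed

text \<open>With a single variable, neighbouring letters that differ are inverse to each other, so a
  reduced word never changes sign.\<close>

lemma reduced_one_variable:
  assumes "reduced w" "fst ` set w \<subseteq> {..<1}"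
  shows "w = replicate (length w) (hd w)"
  using assms
proof (induction w)
  case (Cons x w)
  then have w: "w = replicate (length w) (hd w)" by (simp add: reduced_Cons)
  show ?case
  proof (cases w)
    case (Cons y w')
    then have "y = x"
      using Cons.prems by (auto simp: reduced_Cons inv_letter_def prod_eq_iff)
    then show ?thesis using w Cons by auto
  qed simp
qed simp

context group
begin

section \<open>Values of words in a group\<close>

lemma letter_value_inv_letter:
  assumes "set a \<subseteq> carrier G" "fst x < length a"
  shows "letter_value G a (inv_letter x) = inv (letter_value G a x)"
  using subsetD[OF assms(1) nth_mem[OF assms(2)]] by (auto simp: letter_value_def inv_letter_def)

lemma word_value_Nil [simp]: "word_value G a [] = \<one>"
  by (simp add: word_value_def)

lemma word_value_Cons [simp]: "word_value G a (x # w) = letter_value G a x \<otimes> word_value G a w"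
  by (simp add: word_value_def)

lemma word_value_append:
  assumes "set a \<subseteq> carrier G" "fst ` set u \<subseteq> {..<length a}" "fst ` set v \<subseteq> {..<length a}"
  shows "word_value G a (u @ v) = word_value G a u \<otimes> word_value G a v"
  using assms(2)
  by (induction u) (use assms in \<open>auto simp: word_value_closed letter_value_closed m_assoc\<close>)

lemma word_value_inv_word:
  assumes a: "set a \<subseteq> carrier G" and w: "fst ` set w \<subseteq> {..<length a}"
  shows "word_value G a (inv_word w) = inv (word_value G a w)"
  using w
proof (induction w)
  case (Cons x w)
  have "inv_word (x # w) = inv_word w @ [inv_letter x]" by (simp add: inv_word_def)
  then show ?case
    using a Cons
    by (simp add: word_value_append fst_set_inv_word word_value_closed letter_value_closed
        letter_value_inv_letter inv_mult_group)
qed (simp add: inv_word_def)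

lemma word_value_replicate:
  assumes "set a \<subseteq> carrier G" "fst x < length a"
  shows "word_value G a (replicate n x) = letter_value G a x [^] n"
  using letter_value_closed[OF assms] by (induction n) (simp_all flip: nat_pow_Suc2)

section \<open>Edges of the Cayley graph crossed by letters\<close>

lemma edge_ends_letter_edge:
  assumes "set a \<subseteq> carrier G" "fst x < length a" "g \<in> carrier G"
  shows "edge_ends G a (letter_edge G a g x) = {g, g \<otimes> letter_value G a x}"
  using assms(3) subsetD[OF assms(1) nth_mem[OF assms(2)]]
  by (auto simp: edge_ends_def letter_edge_def letter_value_def m_assoc)

lemma letter_edge_in_cayley_edges:
  assumes "set a \<subseteq> carrier G" "fst x < length a" "g \<in> carrier G"
  shows "letter_edge G a g x \<in> cayley_edges G a"
  using assms letter_value_closed[OF assms(1,2)] by (auto simp: cayley_edges_def letter_edge_def)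

text \<open>Turns a cancelling pair of letters into a repeated edge.\<close>

lemma letter_edge_reverse:
  assumes "set a \<subseteq> carrier G" "fst x < length a" "g \<in> carrier G"
  shows "letter_edge G a (g \<otimes> letter_value G a x) (inv_letter x) = letter_edge G a g x"
  using assms letter_value_closed[OF assms(1,2)]
  by (auto simp: letter_edge_def letter_value_inv_letter m_assoc) (auto simp: inv_letter_def)

text \<open>\<open>edge_ends\<close> forgets the direction: \<open>g\<close> may be the base point
  of \<open>e\<close> or its other end, and the sign of the letter records which.\<close>

lemma letter_edge_cases:
  assumes a: "set a \<subseteq> carrier G" and e: "e \<in> cayley_edges G a" "edge_ends G a e = {g, h}"
  shows "\<exists>x. fst x < length a \<and> h = g \<otimes> letter_value G a x \<and> e = letter_edge G a g x"
proof -
  obtain c j where ej: "e = (c, j)" "c \<in> carrier G" "j < length a" "a ! j \<in> carrier G"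
    using a e(1) by (force simp: cayley_edges_def)
  then consider "g = c" "h = c \<otimes> a ! j" | "h = c" "g = c \<otimes> a ! j"
    using e(2) by (auto simp: edge_ends_def doubleton_eq_iff)
  then show ?thesis
  proof cases
    case 1
    then show ?thesis
      using ej by (intro exI[of _ "(j, True)"]) (auto simp: letter_edge_def letter_value_def)
  next
    case 2
    then show ?thesis
      using ej by (intro exI[of _ "(j, False)"]) (auto simp: letter_edge_def letter_value_def m_assoc)
  qed
qed

text \<open>Equal signs force the same base point and hence the same start; opposite signs mean that
  the second crossing runs back over the first.\<close>

lemma letter_edge_eqD:
  assumes "set a \<subseteq> carrier G" "fst x < length a" "g \<in> carrier G" "h \<in> carrier G"
    and eq: "letter_edge G a g x = letter_edge G a h y"
  shows "g = h \<or> y = inv_letter x \<and> h = g \<otimes> letter_value G a x"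
proof (cases "snd x = snd y")
  case True
  then have "x = y" using eq by (auto simp: letter_edge_def prod_eq_iff)
  then show ?thesis
    using assms letter_value_closed[OF assms(1,2)] by (auto simp: letter_edge_def split: if_splits)
next
  case False
  then have y: "y = inv_letter x"
    using eq by (auto simp: letter_edge_def inv_letter_def prod_eq_iff)
  have "h = g \<otimes> letter_value G a x"
    using assms False letter_value_closed[OF assms(1,2)] unfolding y
    by (auto simp: letter_edge_def letter_value_inv_letter m_assoc split: if_splits)
  then show ?thesis using y by simp
qed

section \<open>Simple loops against vanishing words\<close>

text \<open>The letters crossed along the loop spell the word. A cancellation in it would cross one
  edge twice in a row, which distinctness of \<open>es\<close> excludes.\<close>

lemma simple_loop_imp_word:
  assumes a: "set a \<subseteq> carrier G" and loop: "simple_loop G a vs es"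
  shows "\<exists>w. reduced w \<and> length w = length es \<and> w \<noteq> [] \<and> fst ` set w \<subseteq> {..<length a} \<and>
           word_value G a w = \<one>"
proof -
  let ?n = "length vs"
  have n: "?n > 0" "length es = ?n" and vs: "\<And>i. i < ?n \<Longrightarrow> vs ! i \<in> carrier G"
    and es: "set es \<subseteq> cayley_edges G a" "distinct es"
    and ends: "\<And>i. i < ?n \<Longrightarrow> edge_ends G a (es ! i) = {vs ! i, vs ! (Suc i mod ?n)}"
    using loop nth_mem by (auto simp: simple_loop_def)
  have "\<exists>x. fst x < length a \<and> vs ! (Suc i mod ?n) = vs ! i \<otimes> letter_value G a x \<and>
          es ! i = letter_edge G a (vs ! i) x" if "i < ?n" for i
    using that es n by (intro letter_edge_cases a ends) auto
  then obtain x where x: "\<And>i. i < ?n \<Longrightarrow> fst (x i) < length a"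
    and step: "\<And>i. i < ?n \<Longrightarrow> vs ! (Suc i mod ?n) = vs ! i \<otimes> letter_value G a (x i)"
    and edge: "\<And>i. i < ?n \<Longrightarrow> es ! i = letter_edge G a (vs ! i) (x i)"
    by metis
  let ?w = "map x [0..<?n]"
  have "reduced ?w"
    unfolding reduced_def
  proof (intro allI impI notI)
    fix i assume i: "Suc i < length ?w" and eq: "?w ! Suc i = inv_letter (?w ! i)"
    then have "es ! Suc i = es ! i"
      using edge[of "Suc i"] edge[of i] step[of i] a x[of i] vs[of i]
      by (simp add: letter_edge_reverse)
    then show False using es(2) n i by (simp add: nth_eq_iff_index_eq)
  qed
  \<comment> \<open>Prefixes of the word lead from the first vertex to the later ones. At
    \<open>m = ?n\<close> the index wraps around to 0, so the whole word has value 1 by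
    cancellation.\<close>
  moreover have "vs ! 0 \<otimes> word_value G a (map x [0..<m]) = vs ! (m mod ?n)" if "m \<le> ?n" for m
    using that
  proof (induction m)
    case (Suc m)
    have "word_value G a (map x [0..<Suc m]) = word_value G a (map x [0..<m]) \<otimes> letter_value G a (x m)"
      using Suc.prems a x by (simp add: word_value_append image_subset_iff letter_value_closed)
    moreover have "word_value G a (map x [0..<m]) \<in> carrier G"
      using Suc.prems a x by (intro word_value_closed) auto
    ultimately show ?case
      using Suc a x[of m] vs[of 0] n step[of m] by (simp add: letter_value_closed m_assoc[symmetric])
  qed (use vs n in simp)
  from this[of ?n] have "word_value G a ?w = \<one>"
    using vs n a x word_value_closed[of a ?w] by (auto simp: image_subset_iff)
  ultimately show ?thesis using n x by (intro exI[of _ ?w]) auto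
qed

text \<open>The vertices are the values of the proper prefixes of \<open>w\<close>. Minimality keeps
  them distinct; reducedness then rules out the only remaining way to repeat an edge, immediate
  backtracking.\<close>

lemma shortest_word_imp_simple_loop:
  assumes a: "set a \<subseteq> carrier G"
    and w: "reduced w" "w \<noteq> []" "fst ` set w \<subseteq> {..<length a}" "word_value G a w = \<one>"
    and shortest: "\<And>u. reduced u \<Longrightarrow> u \<noteq> [] \<Longrightarrow> fst ` set u \<subseteq> {..<length a} \<Longrightarrow>
      word_value G a u = \<one> \<Longrightarrow> length w \<le> length u"
  shows "\<exists>vs es. simple_loop G a vs es \<and> length es = length w"
proof -
  define n where "n = length w"
  define v where "v i = word_value G a (take i w)" for i
  define e where "e i = letter_edge G a (v i) (w ! i)" for i
  have n: "n > 0" using w by (simp add: n_def)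
  have sub: "fst ` set u \<subseteq> {..<length a}" if "set u \<subseteq> set w" for u using w(3) that by auto
  have v: "v i \<in> carrier G" for i
    unfolding v_def by (intro word_value_closed a sub set_take_subset)
  have x: "fst (w ! i) < length a" if "i < n" for i
    using that w(3) by (force simp: n_def)
  have v_Suc: "v (Suc i) = v i \<otimes> letter_value G a (w ! i)" if "i < n" for i
    using that a x[OF that]
    by (simp add: v_def n_def take_Suc_conv_app_nth word_value_append sub set_take_subset
        letter_value_closed)
  have v_neq: "v s \<noteq> v t" if st: "s < t" "t < n" for s t
  proof
    assume eq: "v s = v t"
    \<comment> \<open>The segment between two visits to the same vertex vanishes on
      \<open>a\<close>, is reduced and is shorter than \<open>w\<close>.\<close>
    let ?u = "drop s (take t w)"
    have tk: "take t w = take s w @ ?u"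
      using st by (metis append_take_drop_id min.absorb1 less_imp_le take_take)
    have u: "set ?u \<subseteq> set w" by (meson order_trans set_drop_subset set_take_subset)
    have "v t = v s \<otimes> word_value G a ?u"
      unfolding v_def by (subst tk, rule word_value_append) (intro a sub set_take_subset u)+
    then have "word_value G a ?u = \<one>"
      using eq v[of s] word_value_closed[OF a sub[OF u]] by simp
    moreover have "reduced ?u"
      using w(1) tk append_take_drop_id[of t w] by (metis reduced_append)
    ultimately have "length w \<le> length ?u"
      using st by (intro shortest sub u) (auto simp: n_def)
    then show False using st by (auto simp: n_def)
  qed
  then have v_eq_iff: "v s = v t \<longleftrightarrow> s = t" if "s < n" "t < n" for s t
    using that by (metis linorder_neqE_nat)
  \<comment> \<open>The path closes up: \<open>v n\<close> is the value of \<open>w\<close>, which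
    is 1 and so equals \<open>v 0\<close>.\<close>
  have v_mod: "v (Suc i mod n) = v (Suc i)" if "i < n" for i
  proof (cases "Suc i = n")
    case True
    then show ?thesis using w by (simp add: v_def n_def)
  qed (use that in auto)
  have e_neq: "e s \<noteq> e t" if st: "s < t" "t < n" for s t
  proof
    assume "e s = e t"
    then have "v s = v t \<or> w ! t = inv_letter (w ! s) \<and> v t = v s \<otimes> letter_value G a (w ! s)"
      using st x v unfolding e_def by (intro letter_edge_eqD a) auto
    then have "w ! t = inv_letter (w ! s)" "v t = v (Suc s)"
      using v_neq[OF st] v_Suc[of s] st by auto
    \<comment> \<open>Here \<open>Suc s \<le> t < n\<close>, so distinctness of the vertices applies
      to both indices.\<close>
    moreover from this(2) have "t = Suc s" using st v_eq_iff[of t "Suc s"] by auto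
    ultimately show False using w(1) st by (auto simp: reduced_def n_def)
  qed
  then have "inj_on e {..<n}" unfolding inj_on_def by (metis lessThan_iff linorder_neqE_nat)
  then have "simple_loop G a (map v [0..<n]) (map e [0..<n])"
    using n v v_eq_iff
    by (auto simp: simple_loop_def distinct_map inj_on_def e_def x v_mod v_Suc
        letter_edge_in_cayley_edges[OF a] edge_ends_letter_edge[OF a])
  then show ?thesis by (metis n_def length_map length_upt minus_nat.diff_0)
qed

lemma girth_le_iff:
  assumes a: "set a \<subseteq> carrier G"
  shows "girth G a \<le> enat N \<longleftrightarrow>
    (\<exists>w. reduced w \<and> w \<noteq> [] \<and> fst ` set w \<subseteq> {..<length a} \<and> word_value G a w = \<one> \<and> length w \<le> N)"
    (is "_ \<longleftrightarrow> ?R")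
proof
  assume "girth G a \<le> enat N"
  \<comment> \<open>A strict bound on an infimum yields a member of the set below that
    bound.\<close>
  then have "girth G a < enat (Suc N)" by (simp add: order.strict_trans1)
  then obtain vs es where "simple_loop G a vs es" "length es \<le> N"
    by (auto simp: girth_def Inf_less_iff)
  then show ?R
    using simple_loop_imp_word[OF a] by metis
next
  let ?P = "\<lambda>w. reduced w \<and> w \<noteq> [] \<and> fst ` set w \<subseteq> {..<length a} \<and> word_value G a w = \<one>"
  assume ?R
  then obtain w0 where w0: "?P w0" "length w0 \<le> N" by blast
  obtain w where w: "?P w" "\<And>u. ?P u \<Longrightarrow> length w \<le> length u"
    using ex_has_least_nat[of ?P w0 length] w0 by blast
  then obtain vs es where "simple_loop G a vs es" "length es = length w"
    using shortest_word_imp_simple_loop[OF a, of w] by blast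
  then have "girth G a \<le> enat (length w)"
    unfolding girth_def by (intro Inf_lower) (force simp: eq_commute)
  also have "\<dots> \<le> enat N" using w(2)[OF w0(1)] w0(2) by simp
  finally show "girth G a \<le> enat N" .
qed

section \<open>Words that vanish whenever one of several given words does\<close>

lemma common_consequence_word:
  assumes k: "k \<ge> 1"
    and u: "reduced u" "u \<noteq> []" "fst ` set u \<subseteq> {..<k}"
    and v: "reduced v" "v \<noteq> []" "fst ` set v \<subseteq> {..<k}"
  shows "\<exists>z. reduced z \<and> z \<noteq> [] \<and> fst ` set z \<subseteq> {..<k} \<and>
    (\<forall>a. set a \<subseteq> carrier G \<longrightarrow> length a = k \<longrightarrow> word_value G a u = \<one> \<or> word_value G a v = \<one> \<longrightarrow>
      word_value G a z = \<one>)"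
proof (cases "k = 1")
  case True
  define m n x y where "m = length u" "n = length v" "x = hd u" "y = hd v"
  have ux: "u = replicate m x" and vy: "v = replicate n y"
    using u v True reduced_one_variable unfolding m_n_x_y_def by blast+
  have mn: "m > 0" "n > 0" using u v by (auto simp: m_n_x_y_def)
  have x: "fst x = 0" and y: "fst y = 0"
    using u v True by (auto simp: ux vy mn)
  \<comment> \<open>Since \<open>y\<close> is \<open>x\<close> or its inverse, the exponent
    \<open>m * n\<close> is a multiple of both orders that \<open>u\<close> and \<open>v\<close> can
    impose on the value of \<open>x\<close>.\<close>
  let ?z = "replicate (m * n) x"
  have "reduced ?z"
    using True by (auto simp: reduced_def inv_letter_def prod_eq_iff)
  moreover have "word_value G a ?z = \<one>"
    if a: "set a \<subseteq> carrier G" "length a = k" "word_value G a u = \<one> \<or> word_value G a v = \<one>" for a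
  proof -
    let ?g = "letter_value G a"
    have g: "?g x \<in> carrier G" "?g y \<in> carrier G"
      using a k x y by (auto intro!: letter_value_closed)
    have "y = x \<or> y = inv_letter x" using x y by (auto simp: inv_letter_def prod_eq_iff)
    then have "?g y = ?g x \<or> ?g y = inv (?g x)"
      using letter_value_inv_letter[of a x] a k x by auto
    moreover have "?g x [^] m = \<one> \<or> ?g y [^] n = \<one>"
      using a(3) word_value_replicate[OF a(1), of x m] word_value_replicate[OF a(1), of y n] a(2) k x y
      by (simp add: ux vy)
    ultimately have "?g x [^] m = \<one> \<or> ?g x [^] n = \<one>"
      using g by (auto simp: nat_pow_inv inv_eq_1_iff)
    then have "?g x [^] (m * n) = \<one>"
      using g by (metis mult.commute nat_pow_one nat_pow_pow)
    then show ?thesis using word_value_replicate[OF a(1)] a(2) k x by simp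
  qed
  ultimately show ?thesis using mn x True by (intro exI[of _ ?z]) auto
next
  case False
  then have k: "k \<ge> 2" using k by simp
  \<comment> \<open>Avoiding these two letters keeps both \<open>c x u\<close> and
    \<open>c x (inv_word u)\<close> reduced, because inversion exchanges the two conditions.\<close>
  obtain x where x: "fst x < k" "x \<notin> {inv_letter (hd u), last u}"
    by (rule ex_letter_notin[OF k, of "{inv_letter (hd u), last u}"]) (auto simp: card_insert_if)
  \<comment> \<open>The third condition, that \<open>y\<close> differs from \<open>x\<close>,
    prevents cancellation between consecutive blocks of \<open>?z\<close>.\<close>
  obtain y where y: "fst y < k" "y \<notin> {inv_letter (hd v), last v, x}"
    by (rule ex_letter_notin[OF k, of "{inv_letter (hd v), last v, x}"]) (auto simp: card_insert_if)
  define c where "c t w = t # w @ [inv_letter t]" for t w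
  \<comment> \<open>The commutator of the two conjugates: the third and fourth blocks are the
    inverses of the first and second.\<close>
  let ?z = "c x u @ c y v @ c x (inv_word u) @ c y (inv_word v)"
  have red: "reduced (c x u)" "reduced (c y v)" "reduced (c x (inv_word u))" "reduced (c y (inv_word v))"
    using u v x y unfolding c_def
    by (auto intro!: reduced_conjugate
        simp: reduced_inv_word hd_inv_word last_inv_word inv_letter_eq_iff)
  have c: "c t w \<noteq> []" "hd (c t w) = t" "last (c t w) = inv_letter t" for t w
    by (auto simp: c_def)
  have set_c: "fst ` set (c t w) \<subseteq> {..<k}" if "fst t < k" "fst ` set w \<subseteq> {..<k}" for t w
    using that by (auto simp: c_def)
  have "reduced ?z" using red y by (auto simp: reduced_append c)
  moreover have z: "fst ` set ?z \<subseteq> {..<k}"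
    using set_c[of x u] set_c[of y v] set_c[of x "inv_word u"] set_c[of y "inv_word v"] u v x y
    by (simp add: fst_set_inv_word image_Un)
  moreover have "word_value G a ?z = \<one>"
    if a: "set a \<subseteq> carrier G" "length a = k" "word_value G a u = \<one> \<or> word_value G a v = \<one>" for a
  proof -
    have val_c: "word_value G a (c t w) =
        letter_value G a t \<otimes> word_value G a w \<otimes> inv letter_value G a t"
      and closed: "letter_value G a t \<in> carrier G" "word_value G a w \<in> carrier G"
        "word_value G a (c t w) \<in> carrier G"
      if "fst t < k" "fst ` set w \<subseteq> {..<k}" for t w
      using that a set_c[OF that]
      by (auto simp: c_def word_value_append letter_value_closed word_value_closed
          letter_value_inv_letter m_assoc)
    have inv_c: "word_value G a (c t (inv_word w)) = inv (word_value G a (c t w))"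
      if "fst t < k" "fst ` set w \<subseteq> {..<k}" for t w
      using that closed[OF that] a
      by (simp add: val_c fst_set_inv_word word_value_inv_word inv_mult_group m_assoc)
    have "word_value G a ?z = word_value G a (c x u) \<otimes> (word_value G a (c y v) \<otimes>
        (inv (word_value G a (c x u)) \<otimes> inv (word_value G a (c y v))))"
      using a u v x y set_c
      by (simp add: word_value_append fst_set_inv_word image_Un inv_c)
    \<comment> \<open>Conjugation preserves triviality, and a commutator with a trivial entry is
      trivial.\<close>
    moreover have "word_value G a (c x u) = \<one> \<or> word_value G a (c y v) = \<one>"
      using a(3) val_c[OF x(1) u(3)] val_c[OF y(1) v(3)] closed[OF x(1) u(3)] closed[OF y(1) v(3)]
      by auto
    ultimately show ?thesis
      using closed[OF x(1) u(3)] closed[OF y(1) v(3)] by auto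
  qed
  ultimately show ?thesis using c(1) by (intro exI[of _ ?z]) auto
qed

text \<open>Induction on \<open>W\<close>, merging one further word at a time into the word already
  found.\<close>

lemma common_consequence_finite:
  assumes k: "k \<ge> 1" and "finite W"
    and "\<And>w. w \<in> W \<Longrightarrow> reduced w \<and> w \<noteq> [] \<and> fst ` set w \<subseteq> {..<k}"
  shows "\<exists>z. reduced z \<and> z \<noteq> [] \<and> fst ` set z \<subseteq> {..<k} \<and>
    (\<forall>a. set a \<subseteq> carrier G \<longrightarrow> length a = k \<longrightarrow> (\<exists>w\<in>W. word_value G a w = \<one>) \<longrightarrow>
      word_value G a z = \<one>)"
  using assms(2,3)
proof (induction W)
  case empty
  \<comment> \<open>For empty \<open>W\<close> any non-trivial word will do;
    \<open>k \<ge> 1\<close> provides a variable.\<close>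
  show ?case using k by (intro exI[of _ "[(0, True)]"]) (auto simp: reduced_Cons)
next
  case (insert u W)
  then obtain v where v: "reduced v" "v \<noteq> []" "fst ` set v \<subseteq> {..<k}"
    "\<And>a. set a \<subseteq> carrier G \<Longrightarrow> length a = k \<Longrightarrow> (\<exists>w\<in>W. word_value G a w = \<one>) \<Longrightarrow>
      word_value G a v = \<one>"
    by blast
  have "reduced u" "u \<noteq> []" "fst ` set u \<subseteq> {..<k}" using insert.prems by auto
  from common_consequence_word[OF k this v(1-3)] v(4) show ?case by fast
qed

end

theorem theorem8:
  fixes G :: "('a, 'b) monoid_scheme" and k :: nat
  assumes "group G"
    and "k \<ge> 1"
    and "\<exists>a. generating_tuple G k a"
  shows "(\<exists>N :: nat. \<forall>a. generating_tuple G k a \<longrightarrow> girth G a \<le> enat N) \<longleftrightarrow>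
         (\<exists>u \<in> carrier (free_group k). u \<noteq> \<one>\<^bsub>free_group k\<^esub> \<and> almost_identity G k u)"
proof
  interpret group G by fact
  assume "\<exists>N :: nat. \<forall>a. generating_tuple G k a \<longrightarrow> girth G a \<le> enat N"
  then obtain N where N: "\<And>a. generating_tuple G k a \<Longrightarrow> girth G a \<le> enat N" by blast
  \<comment> \<open>All words that can witness girth at most \<open>N\<close>. The set does not
    depend on the tuple and is finite, as there are only \<open>2 * k\<close> letters.\<close>
  let ?W = "{w. reduced w \<and> w \<noteq> [] \<and> fst ` set w \<subseteq> {..<k} \<and> length w \<le> N}"
  have "?W \<subseteq> {w. set w \<subseteq> {..<k} \<times> UNIV \<and> length w \<le> N}" by fastforce
  then have "finite ?W"
    by (rule finite_subset) (intro finite_lists_length_le finite_cartesian_product, auto)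
  from common_consequence_finite[OF assms(2) this] obtain z
    where z: "reduced z" "z \<noteq> []" "fst ` set z \<subseteq> {..<k}"
      "\<And>a. set a \<subseteq> carrier G \<Longrightarrow> length a = k \<Longrightarrow> (\<exists>w\<in>?W. word_value G a w = \<one>\<^bsub>G\<^esub>) \<Longrightarrow>
        word_value G a z = \<one>\<^bsub>G\<^esub>"
    by blast
  have "word_value G a z = \<one>\<^bsub>G\<^esub>" if a: "generating_tuple G k a" for a
    using a N[OF a] girth_le_iff[of a N] by (intro z(4)) (auto simp: generating_tuple_def)
  then show "\<exists>u \<in> carrier (free_group k). u \<noteq> \<one>\<^bsub>free_group k\<^esub> \<and> almost_identity G k u"
    using z by (intro bexI[of _ z]) (auto simp: free_group_def almost_identity_def)
next
  interpret group G by fact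
  assume "\<exists>u \<in> carrier (free_group k). u \<noteq> \<one>\<^bsub>free_group k\<^esub> \<and> almost_identity G k u"
  then obtain u where u: "reduced u" "u \<noteq> []" "fst ` set u \<subseteq> {..<k}"
    "\<And>a. generating_tuple G k a \<Longrightarrow> word_value G a u = \<one>\<^bsub>G\<^esub>"
    by (auto simp: free_group_def almost_identity_def)
  \<comment> \<open>The almost identity itself vanishes on every generating tuple, so its length is
    a uniform bound.\<close>
  have "girth G a \<le> enat (length u)" if a: "generating_tuple G k a" for a
    using a u(1-3) u(4)[OF a] girth_le_iff[of a "length u"] by (auto simp: generating_tuple_def)
  then show "\<exists>N :: nat. \<forall>a. generating_tuple G k a \<longrightarrow> girth G a \<le> enat N" by blast
qed

end
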